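(* Let $J$ be a normal uniform $\gamma$-saturated ideal on a cardinal $\kappa$ for some $\gamma<\kappa$. Then for every ordinal $\nu\in[\gamma,\kappa)$, the $|\nu|$-$J^2$-weak-$\Delta$-system lemma holds; that is: for every $X\in(J^2)^+$ and every family $\langle X_a\in[\kappa]^{<|\nu|}:a\in X\rangle$ there exist $W:[\kappa]^{\le1}\to[\kappa]^{<|\nu|}$ and $Y\subseteq X$ with $Y\in(J^2)^+$ such that for all distinct $a,b\in Y$ with $a\simeq b$, $X_a\cap X_b\subseteq W(a\cap b)$.
   Context: All ideals are proper ($\kappa\notin J$) and uniform ($[\kappa]^{<\kappa}\subseteq J$); $J^*$ is the dual filter, $J^+$ the positive sets; normality is in the usual sense. $J$ is $\gamma$-saturated if for every $\langle X_i:i<\gamma\rangle\subseteq J^+$ there are $i<j<\gamma$ with $X_i\cap X_j\in J^+$. $[\kappa]^2$ is the set of pairs $(\alpha,\beta)$ with $\alpha<\beta<\kappa$, identified with 2-element subsets; $[\kappa]^{\le 1}$ is the set of subsets of $\kappa$ of size at most 1. $X\subseteq[\kappa]^2$ is in $J^2$ iff $\{\alpha:\{\beta:(\alpha,\beta)\in X\}\in J\}\in J^*$; $(J^2)^+$ denotes the $J^2$-positive sets. For $a,b\in[\kappa]^2$, $a\simeq b$ means the order-preserving bijection from $a$ onto $b$ is the identity on $a\cap b$. *)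

theory Defs
  imports Main
begin

text \<open>
  A cardinal \<open>\<kappa>\<close> is a relation with \<open>Card_order \<kappa>\<close>. The ordinals below \<open>\<kappa>\<close> are the elements of
  \<open>Field \<kappa>\<close>; such an ordinal \<open>\<xi>\<close>, regarded as the set of its predecessors, is \<open>underS \<kappa> \<xi>\<close>, so
  that \<open>\<alpha> < \<beta>\<close> reads \<open>\<alpha> \<in> underS \<kappa> \<beta>\<close> and the cardinality of \<open>\<xi>\<close> is \<open>card_of (underS \<kappa> \<xi>)\<close>.
\<close>

definition ideal_on :: "'a set \<Rightarrow> 'a set set \<Rightarrow> bool" where
  "ideal_on S J \<longleftrightarrow>
     J \<subseteq> Pow S \<and> {} \<in> J \<and>
     (\<forall>A\<in>J. \<forall>B. B \<subseteq> A \<longrightarrow> B \<in> J) \<and>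
     (\<forall>A\<in>J. \<forall>B\<in>J. A \<union> B \<in> J)"

definition dual_filter :: "'a set \<Rightarrow> 'a set set \<Rightarrow> 'a set set" where
  "dual_filter S J = {A. A \<subseteq> S \<and> S - A \<in> J}"

definition positive_sets :: "'a set \<Rightarrow> 'a set set \<Rightarrow> 'a set set" where
  "positive_sets S J = {A. A \<subseteq> S \<and> A \<notin> J}"

text \<open>Written \<open>[S]^{<\<mu>}\<close> on paper; \<open>\<mu>\<close> is a cardinal.\<close>

definition subsets_less :: "'a set \<Rightarrow> 'b rel \<Rightarrow> 'a set set" where
  "subsets_less S \<mu> = {A. A \<subseteq> S \<and> (card_of A, \<mu>) \<in> ordLess}"

definition subsets_le_one :: "'a set \<Rightarrow> 'a set set" where
  "subsets_le_one S = {A. A \<subseteq> S \<and> finite A \<and> card A \<le> 1}"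

definition proper_uniform_ideal :: "'k rel \<Rightarrow> 'k set set \<Rightarrow> bool" where
  "proper_uniform_ideal \<kappa> J \<longleftrightarrow>
     ideal_on (Field \<kappa>) J \<and> Field \<kappa> \<notin> J \<and> subsets_less (Field \<kappa>) \<kappa> \<subseteq> J"

definition diagonal_union :: "'k rel \<Rightarrow> ('k \<Rightarrow> 'k set) \<Rightarrow> 'k set" where
  "diagonal_union \<kappa> A = {\<beta> \<in> Field \<kappa>. \<exists>\<alpha>\<in>underS \<kappa> \<beta>. \<beta> \<in> A \<alpha>}"

definition normal_ideal :: "'k rel \<Rightarrow> 'k set set \<Rightarrow> bool" where
  "normal_ideal \<kappa> J \<longleftrightarrow> (\<forall>A. (\<forall>\<alpha>\<in>Field \<kappa>. A \<alpha> \<in> J) \<longrightarrow> diagonal_union \<kappa> A \<in> J)"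

definition saturated_ideal :: "'k rel \<Rightarrow> 'k \<Rightarrow> 'k set set \<Rightarrow> bool" where
  "saturated_ideal \<kappa> \<gamma> J \<longleftrightarrow>
     (\<forall>X. (\<forall>i\<in>underS \<kappa> \<gamma>. X i \<in> positive_sets (Field \<kappa>) J) \<longrightarrow>
        (\<exists>j\<in>underS \<kappa> \<gamma>. \<exists>i\<in>underS \<kappa> j. X i \<inter> X j \<in> positive_sets (Field \<kappa>) J))"

definition pairs :: "'k rel \<Rightarrow> ('k \<times> 'k) set" where
  "pairs \<kappa> = {(\<alpha>, \<beta>). \<beta> \<in> Field \<kappa> \<and> \<alpha> \<in> underS \<kappa> \<beta>}"

definition pair_set :: "'k \<times> 'k \<Rightarrow> 'k set" where
  "pair_set a = {fst a, snd a}"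

definition ideal_square :: "'k rel \<Rightarrow> 'k set set \<Rightarrow> ('k \<times> 'k) set set" where
  "ideal_square \<kappa> J =
     {X. X \<subseteq> pairs \<kappa> \<and>
         {\<alpha> \<in> Field \<kappa>. {\<beta> \<in> Field \<kappa>. (\<alpha>, \<beta>) \<in> X} \<in> J} \<in> dual_filter (Field \<kappa>) J}"

text \<open>
  For \<open>a\<close> and \<open>b\<close> of equal finite size the order-preserving bijection exists and is unique, so
  the existential quantifier expresses that this bijection is the identity on \<open>a \<inter> b\<close>.
\<close>

definition same_position :: "'k rel \<Rightarrow> 'k set \<Rightarrow> 'k set \<Rightarrow> bool" where
  "same_position \<kappa> a b \<longleftrightarrow>
     (\<exists>f. bij_betw f a b \<and> (\<forall>x\<in>a. \<forall>y\<in>a. (x, y) \<in> \<kappa> \<longrightarrow> (f x, f y) \<in> \<kappa>) \<and>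
          (\<forall>x\<in>a \<inter> b. f x = x))"

text \<open>
  The \<open>\<mu>\<close>-\<open>K\<close>-weak-\<open>\<Delta>\<close>-system lemma, for a cardinal \<open>\<mu>\<close> and a family \<open>K\<close> of sets of pairs.
  The values of \<open>F\<close> off \<open>X\<close> and of \<open>W\<close> off the subsets of size at most one are irrelevant.
\<close>

definition weak_Delta_system_lemma ::
    "'k rel \<Rightarrow> 'b rel \<Rightarrow> ('k \<times> 'k) set set \<Rightarrow> bool" where
  "weak_Delta_system_lemma \<kappa> \<mu> K \<longleftrightarrow>
     (\<forall>X \<in> positive_sets (pairs \<kappa>) K. \<forall>F.
        (\<forall>a\<in>X. F a \<in> subsets_less (Field \<kappa>) \<mu>) \<longrightarrow>
        (\<exists>W Y. (\<forall>s \<in> subsets_le_one (Field \<kappa>). W s \<in> subsets_less (Field \<kappa>) \<mu>) \<and>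
               Y \<subseteq> X \<and> Y \<in> positive_sets (pairs \<kappa>) K \<and>
               (\<forall>a\<in>Y. \<forall>b\<in>Y.
                  a \<noteq> b \<and> same_position \<kappa> (pair_set a) (pair_set b) \<longrightarrow>
                  F a \<inter> F b \<subseteq> W (pair_set a \<inter> pair_set b))))"

end

theory Submission
  imports Defs "HOL-Library.Disjoint_Sets"
begin

text \<open>
  The engine is a pressing-down lemma for set-valued maps: if \<open>G \<beta> \<subseteq> \<beta>\<close> has fewer than \<open>\<mu> = |\<nu>|\<close>
  elements for all \<open>\<beta>\<close> in a positive set, then on a smaller positive set all \<open>G \<beta>\<close> lie in one set of
  size less than \<open>\<mu>\<close>. By saturation each of the regressive functions enumerating \<open>G\<close> has, modulo
  \<open>J\<close>, fewer than \<open>\<gamma>\<close> values; that the union over all of them is still small is seen on a positive set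
  all of whose positive subsets have the same possible sizes of antichains.

  Pressing down in the second coordinate confines \<open>X\<^bsub>(\<alpha>,\<beta>)\<^esub> \<inter> \<beta>\<close> to a small set \<open>Z\<^sub>\<alpha>\<close>, and pressing
  down in the first confines \<open>Z\<^sub>\<alpha> \<inter> \<alpha>\<close> to a small set \<open>Z\<^sub>0\<close>; on suitable closure sets this settles all
  pairs with different maxima. For \<open>\<alpha>' < \<alpha>\<close> and a common maximum \<open>\<beta>\<close>, a common element \<open>\<xi> \<ge> \<beta>\<close> is
  coded by such an \<open>\<alpha>'\<close> and the index of \<open>\<xi>\<close> in \<open>X\<^bsub>(\<alpha>',\<beta>)\<^esub>\<close>. These codes can be pressed down in both
  coordinates, and decoding the resulting small set at \<open>\<beta>\<close> covers the intersection.
\<close>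

unbundle cardinal_syntax

section \<open>Cardinal comparison for finite sets\<close>

lemma card_of_less_iff_card_less:
  assumes "finite A" "finite B"
  shows "|A| <o |B| \<longleftrightarrow> card A < card B"
proof -
  have "(\<exists>f. inj_on f B \<and> f ` B \<subseteq> A) \<longleftrightarrow> card B \<le> card A"
    using assms card_inj_on_le card_le_inj by metis
  then show ?thesis
    using card_of_ordLess[of B A] by auto
qed

lemma finite_card_of_less_infinite: "finite A \<Longrightarrow> infinite B \<Longrightarrow> |A| <o |B|"
  by (rule finite_ordLess_infinite[OF card_of_Well_order card_of_Well_order]) (simp_all add: Field_card_of)

section \<open>The well-order \<open>\<kappa>\<close> and the sizes of its initial segments\<close>

locale normal_saturated_ideal =
  fixes \<kappa> :: "'k rel" and J :: "'k set set" and \<gamma> :: 'k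
  assumes card_order: "Card_order \<kappa>"
    and proper_uniform: "proper_uniform_ideal \<kappa> J"
    and normal: "normal_ideal \<kappa> J"
    and \<gamma>_in_Field: "\<gamma> \<in> Field \<kappa>"
    and saturated: "saturated_ideal \<kappa> \<gamma> J"
begin

abbreviation prec (infix "\<prec>" 50) where "x \<prec> y \<equiv> x \<in> underS \<kappa> y"
abbreviation S where "S \<equiv> Field \<kappa>"

lemma Well_order: "Well_order \<kappa>"
  using card_order by (simp add: card_order_on_def)

lemma wo_rel: "wo_rel \<kappa>"
  using Well_order by (simp add: wo_rel_def)

lemma prec_in_Field: "x \<prec> y \<Longrightarrow> x \<in> S \<and> y \<in> S"
  by (auto simp: underS_def Field_def)

lemma underS_subset_Field: "underS \<kappa> x \<subseteq> S"
  using prec_in_Field by blast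

lemma prec_irrefl [simp]: "\<not> x \<prec> x"
  by (simp add: underS_def)

lemma prec_trans: "x \<prec> y \<Longrightarrow> y \<prec> z \<Longrightarrow> x \<prec> z"
  using wo_rel.TRANS[OF wo_rel] wo_rel.ANTISYM[OF wo_rel]
  unfolding underS_def trans_def antisym_def by blast

lemma prec_linear: "x \<in> S \<Longrightarrow> y \<in> S \<Longrightarrow> x \<prec> y \<or> x = y \<or> y \<prec> x"
  using wo_rel.TOTAL[OF wo_rel] unfolding underS_def total_on_def by auto

lemma prec_le_trans: "x \<prec> y \<Longrightarrow> (y, z) \<in> \<kappa> \<Longrightarrow> x \<prec> z"
  using prec_trans[of x y z] by (cases "y = z") (auto simp: underS_def)

lemma le_iff_prec_or_eq: "(x, y) \<in> \<kappa> \<longleftrightarrow> x \<prec> y \<or> x = y \<and> x \<in> S"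
  using wo_rel.REFL[OF wo_rel] unfolding underS_def refl_on_def
  by (auto simp: Field_def)

lemma ex_least:
  assumes "Q x" "x \<in> S"
  obtains m where "m \<in> S" "Q m" "\<And>y. y \<prec> m \<Longrightarrow> \<not> Q y"
proof -
  have "wf (\<kappa> - Id)"
    using Well_order by (simp add: well_order_on_def)
  then obtain m where m: "m \<in> {z \<in> S. Q z}"
    and min: "\<And>y. (y, m) \<in> \<kappa> - Id \<Longrightarrow> y \<notin> {z \<in> S. Q z}"
    using wfE_min[of "\<kappa> - Id" x "{z \<in> S. Q z}"] assms by blast
  have "\<not> Q y" if "y \<prec> m" for y
    using min[of y] that prec_in_Field[OF that] by (auto simp: underS_def)
  with m show thesis using that by blast
qed

lemma card_underS_less: "\<xi> \<in> S \<Longrightarrow> |underS \<kappa> \<xi>| <o \<kappa>"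
  using card_of_underS[OF card_order] .

lemma card_underS_mono: "(\<xi>, \<eta>) \<in> \<kappa> \<Longrightarrow> |underS \<kappa> \<xi>| \<le>o |underS \<kappa> \<eta>|"
  using prec_le_trans by (intro card_of_mono1) blast

text \<open>\<open>|A|\<close> is isomorphic to a proper initial segment of \<open>\<kappa>\<close>,
  and passing to fields gives the size. Elements of \<open>S\<close> can thus name all cardinals
  below \<open>\<kappa>\<close>.\<close>

lemma ex_card_underS:
  assumes "|A| <o \<kappa>"
  obtains \<xi> where "\<xi> \<in> S" "|A| =o |underS \<kappa> \<xi>|"
proof -
  obtain \<xi> where \<xi>: "\<xi> \<in> S" "|A| =o Restr \<kappa> (underS \<kappa> \<xi>)"
    using assms ordLess_iff_ordIso_Restr[OF Well_order card_of_Well_order] by blast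
  have "Field (Restr \<kappa> (underS \<kappa> \<xi>)) = underS \<kappa> \<xi>"
    using Field_Restr_ofilter[OF Well_order wo_rel.underS_ofilter[OF wo_rel]] .
  with card_of_cong[OF \<xi>(2)] have "|A| =o |underS \<kappa> \<xi>|"
    by (simp add: Field_card_of)
  with \<xi> show thesis using that by blast
qed

lemma ex_card_underS_less:
  assumes "|A| <o |underS \<kappa> \<theta>|" "\<theta> \<in> S"
  obtains \<xi> where "\<xi> \<prec> \<theta>" "|A| =o |underS \<kappa> \<xi>|"
proof -
  have "|A| <o \<kappa>"
    using assms card_underS_less ordLess_transitive by blast
  then obtain \<xi> where \<xi>: "\<xi> \<in> S" "|A| =o |underS \<kappa> \<xi>|"
    using ex_card_underS by blast
  have "\<xi> \<prec> \<theta>"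
  proof (rule ccontr)
    assume "\<not> \<xi> \<prec> \<theta>"
    then have "(\<theta>, \<xi>) \<in> \<kappa>"
      using prec_linear[OF \<xi>(1) assms(2)] assms(2) by (auto simp: le_iff_prec_or_eq)
    then have "|underS \<kappa> \<theta>| \<le>o |A|"
      using card_underS_mono \<xi>(2) ordIso_symmetric ordLeq_ordIso_trans by blast
    then show False
      using assms(1) not_ordLess_ordLeq by blast
  qed
  with \<xi> show thesis using that by blast
qed

section \<open>Null and positive sets of the ideal\<close>

lemma J_subset: "A \<in> J \<Longrightarrow> A \<subseteq> S"
  and empty_in_J: "{} \<in> J"
  and J_mono: "A \<in> J \<Longrightarrow> B \<subseteq> A \<Longrightarrow> B \<in> J"
  and J_Un: "A \<in> J \<Longrightarrow> B \<in> J \<Longrightarrow> A \<union> B \<in> J"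
  and Field_notin_J: "S \<notin> J"
  and small_in_J: "A \<subseteq> S \<Longrightarrow> |A| <o \<kappa> \<Longrightarrow> A \<in> J"
  using proper_uniform
  unfolding proper_uniform_ideal_def ideal_on_def subsets_less_def by blast+

lemma positive_diff:
  assumes "B \<notin> J" "N \<in> J" "B - N \<subseteq> C"
  shows "C \<notin> J"
  using assms J_Un[of C N] J_mono[of "C \<union> N" B] by blast

text \<open>In a finite \<open>S\<close> with a second element all singletons are smaller than
  \<open>S\<close>, hence null, and their union \<open>S\<close> would be null. If
  \<open>\<gamma>\<close> is the only element, it indexes the empty family, in which saturation
  would find two members.\<close>

lemma infinite_Field: "infinite S"
proof
  assume fin: "finite S"
  show False
  proof (cases "\<exists>x\<in>S. x \<noteq> \<gamma>")
    case True
    then obtain x where x: "x \<in> S" "x \<noteq> \<gamma>" by blast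
    have sing: "{y} \<in> J" if "y \<in> S" for y
    proof (rule small_in_J)
      have "{y} \<subset> S"
        using x \<gamma>_in_Field that by (cases "y = \<gamma>") auto
      then have "card {y} < card S"
        by (rule psubset_card_mono[OF fin])
      then have "|{y}| <o |S|"
        using fin card_of_less_iff_card_less[of "{y}" S] by simp
      then show "|{y}| <o \<kappa>"
        using card_of_Field_ordIso[OF card_order] ordLess_ordIso_trans by blast
    qed (use that in simp)
    have "T \<in> J" if "finite T" "T \<subseteq> S" for T
      using that
    proof (induction T)
      case (insert t T)
      then show ?case using sing[of t] J_Un[of "{t}" T] by simp
    qed (rule empty_in_J)
    then show False using fin Field_notin_J by blast
  next
    case False
    then have "underS \<kappa> \<gamma> = {}"
      using prec_in_Field by fastforce
    then show False
      using saturated unfolding saturated_ideal_def by simp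
  qed
qed

lemma finite_card_less: "finite A \<Longrightarrow> |A| <o \<kappa>"
  by (rule finite_ordLess_infinite[OF card_of_Well_order Well_order])
    (simp_all add: Field_card_of infinite_Field)

lemma initial_segment_in_J: "\<xi> \<in> S \<Longrightarrow> {\<beta> \<in> S. \<not> \<xi> \<prec> \<beta>} \<in> J"
proof -
  assume \<xi>: "\<xi> \<in> S"
  have "underS \<kappa> \<xi> \<in> J"
    by (rule small_in_J[OF underS_subset_Field card_underS_less[OF \<xi>]])
  moreover have "{\<xi>} \<in> J"
    using \<xi> by (intro small_in_J finite_card_less) auto
  ultimately have "underS \<kappa> \<xi> \<union> {\<xi>} \<in> J"
    by (rule J_Un)
  moreover have "{\<beta> \<in> S. \<not> \<xi> \<prec> \<beta>} \<subseteq> underS \<kappa> \<xi> \<union> {\<xi>}"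
    using prec_linear[OF \<xi>] by blast
  ultimately show ?thesis
    using J_mono by blast
qed

lemma diagonal_union_in_J:
  assumes "\<And>\<alpha>. \<alpha> \<in> S \<Longrightarrow> A \<alpha> \<in> J"
  shows "{\<beta> \<in> S. \<exists>\<alpha>. \<alpha> \<prec> \<beta> \<and> \<beta> \<in> A \<alpha>} \<in> J"
  using normal assms unfolding normal_ideal_def diagonal_union_def Bex_def by blast

section \<open>Pressing down for functions\<close>

text \<open>One notion for Fodor's lemma (\<open>T \<beta>\<close> is
  \<open>underS \<kappa> \<beta>\<close>) and for completeness (\<open>T\<close> constant), so that
  products of the two kinds can be treated alike.\<close>

definition pressable :: "'k set \<Rightarrow> ('k \<Rightarrow> 't set) \<Rightarrow> bool" where
  "pressable B T \<longleftrightarrow> (\<forall>B'\<subseteq>B. \<forall>f. B' \<notin> J \<longrightarrow> (\<forall>\<beta>\<in>B'. f \<beta> \<in> T \<beta>) \<longrightarrow>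
     (\<exists>c. {\<beta> \<in> B'. f \<beta> = c} \<notin> J))"

lemma pressableD:
  assumes "pressable B T" "B' \<subseteq> B" "B' \<notin> J" "\<And>\<beta>. \<beta> \<in> B' \<Longrightarrow> f \<beta> \<in> T \<beta>"
  obtains c where "{\<beta> \<in> B'. f \<beta> = c} \<notin> J"
  using assms unfolding pressable_def by blast

text \<open>Fodor's lemma: if all fibres of a regressive map were null, its domain would lie in
  their diagonal union.\<close>

lemma pressable_underS:
  assumes "B \<subseteq> S"
  shows "pressable B (underS \<kappa>)"
  unfolding pressable_def
proof (intro allI impI)
  fix B' and f :: "'k \<Rightarrow> 'k"
  assume B': "B' \<subseteq> B" "B' \<notin> J" and f: "\<forall>\<beta>\<in>B'. f \<beta> \<prec> \<beta>"
  show "\<exists>c. {\<beta> \<in> B'. f \<beta> = c} \<notin> J"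
  proof (rule ccontr)
    assume "\<not> ?thesis"
    then have "{\<beta> \<in> S. \<exists>c. c \<prec> \<beta> \<and> \<beta> \<in> {\<beta> \<in> B'. f \<beta> = c}} \<in> J"
      by (intro diagonal_union_in_J) blast
    then have "B' \<in> J"
      by (rule J_mono) (use B' f assms in blast)
    with B' show False by blast
  qed
qed

text \<open>An embedding of \<open>T\<close> into some \<open>\<xi>\<close> makes the map regressive
  beyond \<open>\<xi>\<close>, and the points up to \<open>\<xi>\<close> form a null set.\<close>

lemma pressable_const:
  assumes "B \<subseteq> S" "|T| <o \<kappa>"
  shows "pressable B (\<lambda>_. T)"
  unfolding pressable_def
proof (intro allI impI)
  fix B' and f :: "'k \<Rightarrow> 'a"
  assume B': "B' \<subseteq> B" "B' \<notin> J" and f: "\<forall>\<beta>\<in>B'. f \<beta> \<in> T"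
  obtain \<xi> where \<xi>: "\<xi> \<in> S" "|T| =o |underS \<kappa> \<xi>|"
    using ex_card_underS[OF assms(2)] .
  then obtain e where e: "inj_on e T" "e ` T \<subseteq> underS \<kappa> \<xi>"
    using card_of_ordLeq[of T "underS \<kappa> \<xi>"] ordIso_imp_ordLeq by blast
  let ?C = "{\<beta> \<in> B'. \<xi> \<prec> \<beta>}"
  have "?C \<notin> J"
    by (rule positive_diff[OF B'(2) initial_segment_in_J[OF \<xi>(1)]]) (use B' assms in blast)
  moreover have "e (f \<beta>) \<prec> \<beta>" if "\<beta> \<in> ?C" for \<beta>
  proof -
    have "e (f \<beta>) \<prec> \<xi>" using e f that by blast
    then show ?thesis using that prec_trans by blast
  qed
  ultimately obtain c where c: "{\<beta> \<in> ?C. e (f \<beta>) = c} \<notin> J"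
    using pressableD[OF pressable_underS[OF assms(1)], of ?C "\<lambda>\<beta>. e (f \<beta>)"] B' by blast
  then have "{\<beta> \<in> ?C. e (f \<beta>) = c} \<noteq> {}"
    using empty_in_J by metis
  then obtain \<beta>0 where \<beta>0: "\<beta>0 \<in> B'" "e (f \<beta>0) = c"
    by blast
  have "{\<beta> \<in> ?C. e (f \<beta>) = c} \<subseteq> {\<beta> \<in> B'. f \<beta> = f \<beta>0}"
    using \<beta>0 e f by (auto simp: inj_on_def)
  then show "\<exists>c. {\<beta> \<in> B'. f \<beta> = c} \<notin> J"
    using c J_mono by blast
qed

text \<open>Press the first components, then the second ones on the positive fibre so
  obtained.\<close>

lemma pressable_Times:
  assumes T: "pressable B T" and U: "pressable B U"
  shows "pressable B (\<lambda>\<beta>. T \<beta> \<times> U \<beta>)"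
  unfolding pressable_def
proof (intro allI impI)
  fix B' and f :: "'k \<Rightarrow> 'a \<times> 'b"
  assume B': "B' \<subseteq> B" "B' \<notin> J" and f: "\<forall>\<beta>\<in>B'. f \<beta> \<in> T \<beta> \<times> U \<beta>"
  have "fst (f \<beta>) \<in> T \<beta>" if "\<beta> \<in> B'" for \<beta>
    using f that by (auto simp: mem_Times_iff)
  then obtain c where c: "{\<beta> \<in> B'. fst (f \<beta>) = c} \<notin> J"
    using pressableD[OF T B', of "\<lambda>\<beta>. fst (f \<beta>)"] by blast
  have "snd (f \<beta>) \<in> U \<beta>" if "\<beta> \<in> {\<beta> \<in> B'. fst (f \<beta>) = c}" for \<beta>
    using f that by (auto simp: mem_Times_iff)
  then obtain d where d: "{\<beta> \<in> {\<beta> \<in> B'. fst (f \<beta>) = c}. snd (f \<beta>) = d} \<notin> J"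
    using pressableD[OF U _ c, of "\<lambda>\<beta>. snd (f \<beta>)"] B' by blast
  have "{\<beta> \<in> B'. f \<beta> = (c, d)} = {\<beta> \<in> {\<beta> \<in> B'. fst (f \<beta>) = c}. snd (f \<beta>) = d}"
    by (auto simp: prod_eq_iff)
  with d show "\<exists>c. {\<beta> \<in> B'. f \<beta> = c} \<notin> J" by metis
qed

lemma pressable_subset: "pressable B T \<Longrightarrow> C \<subseteq> B \<Longrightarrow> pressable C T"
  unfolding pressable_def by blast

text \<open>This is \<open>\<kappa>\<close>-completeness of \<open>J\<close>: choosing an index for
  each point of the union gives a map into \<open>T\<close>, and a positive fibre would sit inside a
  single null set \<open>N t\<close>.\<close>

lemma UN_in_J:
  assumes "|T| <o \<kappa>" "\<And>t. t \<in> T \<Longrightarrow> N t \<in> J"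
  shows "(\<Union>t\<in>T. N t) \<in> J"
proof (rule ccontr)
  assume pos: "(\<Union>t\<in>T. N t) \<notin> J"
  have sub: "(\<Union>t\<in>T. N t) \<subseteq> S"
    using assms J_subset by blast
  define f where "f \<beta> = (SOME t. t \<in> T \<and> \<beta> \<in> N t)" for \<beta>
  have f: "f \<beta> \<in> T \<and> \<beta> \<in> N (f \<beta>)" if "\<beta> \<in> (\<Union>t\<in>T. N t)" for \<beta>
    unfolding f_def by (rule someI_ex) (use that in blast)
  obtain c where c: "{\<beta> \<in> (\<Union>t\<in>T. N t). f \<beta> = c} \<notin> J"
    using pressableD[OF pressable_const[OF sub assms(1)] subset_refl pos, of f] f by blast
  show False
  proof (cases "c \<in> T")
    case True
    have "{\<beta> \<in> (\<Union>t\<in>T. N t). f \<beta> = c} \<subseteq> N c" using f by blast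
    then show False using c assms(2)[OF True] J_mono by blast
  next
    case False
    then have "{\<beta> \<in> (\<Union>t\<in>T. N t). f \<beta> = c} = {}" using f by blast
    then show False using c empty_in_J by metis
  qed
qed

section \<open>Sizes of disjoint positive families\<close>

text \<open>
  Positive disjoint families stand in for antichains of \<open>J\<^sup>+\<close>: by completeness this does not change
  which cardinalities below \<open>\<kappa>\<close> are realized.
\<close>

definition splits :: "'k set \<Rightarrow> 'i set \<Rightarrow> bool" where
  "splits B I \<longleftrightarrow>
     (\<exists>P. (\<forall>i\<in>I. P i \<subseteq> B \<and> P i \<notin> J) \<and> disjoint_family_on P I)"

lemma splits_mono:
  assumes "splits B I" "|K| \<le>o |I|"
  shows "splits B K"
proof -
  obtain P where P: "\<forall>i\<in>I. P i \<subseteq> B \<and> P i \<notin> J" "disjoint_family_on P I"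
    using assms(1) unfolding splits_def by blast
  obtain e where e: "inj_on e K" "e ` K \<subseteq> I"
    using assms(2) card_of_ordLeq[of K I] by blast
  have "\<forall>k\<in>K. P (e k) \<subseteq> B \<and> P (e k) \<notin> J"
    using P(1) e(2) by blast
  moreover have "disjoint_family_on (\<lambda>k. P (e k)) K"
    using P(2) e unfolding disjoint_family_on_def inj_on_def by (metis image_subset_iff)
  ultimately show ?thesis
    unfolding splits_def by (intro exI[of _ "\<lambda>k. P (e k)"]) blast
qed

lemma not_splits_\<gamma>: "B \<subseteq> S \<Longrightarrow> \<not> splits B (underS \<kappa> \<gamma>)"
proof
  assume "B \<subseteq> S" "splits B (underS \<kappa> \<gamma>)"
  then obtain P where P: "\<forall>i\<in>underS \<kappa> \<gamma>. P i \<subseteq> S \<and> P i \<notin> J"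
    "disjoint_family_on P (underS \<kappa> \<gamma>)"
    unfolding splits_def by blast
  then obtain i j where ij: "j \<prec> \<gamma>" "i \<prec> j" "P i \<inter> P j \<notin> J"
    using saturated unfolding saturated_ideal_def positive_sets_def by blast
  then have "P i \<inter> P j = {}"
    using P(2) prec_trans[OF ij(2,1)] by (metis disjoint_family_on_def prec_irrefl)
  with ij empty_in_J show False by simp
qed

lemma splits_card_less: "B \<subseteq> S \<Longrightarrow> splits B I \<Longrightarrow> |I| <o |underS \<kappa> \<gamma>|"
  using not_splits_\<gamma>[of B] splits_mono[of B I "underS \<kappa> \<gamma>"]
  by (meson card_of_Well_order not_ordLess_iff_ordLeq)

text \<open>Taking \<open>B' = B\<close> shows that \<open>\<theta>\<close> is the least index that
  does not split \<open>B\<close>, the saturation degree of \<open>J\<close> below \<open>B\<close>.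
  It must not drop on positive subsets.\<close>

definition homogeneous :: "'k set \<Rightarrow> bool" where
  "homogeneous B \<longleftrightarrow> B \<subseteq> S \<and> B \<notin> J \<and>
     (\<exists>\<theta>\<in>S. \<not> splits B (underS \<kappa> \<theta>) \<and>
        (\<forall>B'\<subseteq>B. B' \<notin> J \<longrightarrow> (\<forall>\<xi>. \<xi> \<prec> \<theta> \<longrightarrow> splits B' (underS \<kappa> \<xi>))))"

text \<open>Choose a positive subset whose degree is least possible; its own positive subsets cannot
  fall below that. Saturation makes \<open>\<gamma>\<close> a candidate for the minimum.\<close>

lemma ex_homogeneous:
  assumes "B \<subseteq> S" "B \<notin> J"
  obtains B' where "B' \<subseteq> B" "homogeneous B'"
proof -
  let ?Q = "\<lambda>\<xi>. \<exists>B'\<subseteq>B. B' \<notin> J \<and> \<not> splits B' (underS \<kappa> \<xi>)"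
  have "?Q \<gamma>" using assms not_splits_\<gamma> by blast
  then obtain \<theta> where \<theta>: "\<theta> \<in> S" "?Q \<theta>" "\<And>\<xi>. \<xi> \<prec> \<theta> \<Longrightarrow> \<not> ?Q \<xi>"
    using ex_least[of ?Q \<gamma>] \<gamma>_in_Field by blast
  obtain B' where B': "B' \<subseteq> B" "B' \<notin> J" "\<not> splits B' (underS \<kappa> \<theta>)"
    using \<theta>(2) by blast
  have "homogeneous B'"
    unfolding homogeneous_def
  proof (intro conjI bexI[of _ \<theta>] allI impI)
    fix C \<xi> assume "C \<subseteq> B'" "C \<notin> J" "\<xi> \<prec> \<theta>"
    then show "splits C (underS \<kappa> \<xi>)" using \<theta>(3)[of \<xi>] B'(1) by blast
  qed (use B' \<theta> assms in auto)
  with B' show thesis using that by blast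
qed

text \<open>A size that splits \<open>B\<close> is below \<open>|underS \<kappa> \<theta>|\<close>,
  hence the size of some \<open>\<xi> \<prec> \<theta>\<close>, and such \<open>\<xi>\<close> split
  every positive subset.\<close>

lemma homogeneous_splits:
  assumes "homogeneous B" "splits B I" "B' \<subseteq> B" "B' \<notin> J"
  shows "splits B' I"
proof -
  obtain \<theta> where \<theta>: "\<theta> \<in> S" "\<not> splits B (underS \<kappa> \<theta>)"
    "\<And>B' \<xi>. B' \<subseteq> B \<Longrightarrow> B' \<notin> J \<Longrightarrow> \<xi> \<prec> \<theta> \<Longrightarrow> splits B' (underS \<kappa> \<xi>)"
    using assms(1) unfolding homogeneous_def by blast
  have "|I| <o |underS \<kappa> \<theta>|"
    using \<theta>(2) splits_mono[OF assms(2), of "underS \<kappa> \<theta>"]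
    by (meson card_of_Well_order not_ordLess_iff_ordLeq)
  then obtain \<xi> where \<xi>: "\<xi> \<prec> \<theta>" "|I| =o |underS \<kappa> \<xi>|"
    using ex_card_underS_less[OF _ \<theta>(1)] by blast
  show ?thesis
    by (rule splits_mono[OF \<theta>(3)[OF assms(3,4) \<xi>(1)] ordIso_imp_ordLeq[OF \<xi>(2)]])
qed

text \<open>This replaces Tarski's theorem that the least saturation degree is regular.\<close>

lemma homogeneous_splits_Sigma:
  assumes hom: "homogeneous B" and I: "splits B I" and K: "\<And>i. i \<in> I \<Longrightarrow> splits B (K i)"
  shows "splits B (Sigma I K)"
proof -
  obtain P where P: "\<forall>i\<in>I. P i \<subseteq> B \<and> P i \<notin> J" "disjoint_family_on P I"
    using I unfolding splits_def by blast
  \<comment> \<open>Homogeneity moves the splitting of \<open>B\<close> along \<open>K i\<close>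
    into the piece \<open>P i\<close>.\<close>
  have "\<forall>i\<in>I. \<exists>Q. (\<forall>k\<in>K i. Q k \<subseteq> P i \<and> Q k \<notin> J) \<and> disjoint_family_on Q (K i)"
    using homogeneous_splits[OF hom K] P(1) unfolding splits_def by blast
  then obtain Q where Q: "\<And>i. i \<in> I \<Longrightarrow> \<forall>k\<in>K i. Q i k \<subseteq> P i \<and> Q i k \<notin> J"
    "\<And>i. i \<in> I \<Longrightarrow> disjoint_family_on (Q i) (K i)"
    by metis
  have "disjoint_family_on (\<lambda>(i, k). Q i k) (Sigma I K)"
    unfolding disjoint_family_on_def
  proof (intro ballI impI)
    fix x y assume xy: "x \<in> Sigma I K" "y \<in> Sigma I K" "x \<noteq> y"
    obtain i k i' k' where eq: "x = (i, k)" "y = (i', k')" by fastforce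
    with xy have *: "i \<in> I" "k \<in> K i" "i' \<in> I" "k' \<in> K i'" "(i, k) \<noteq> (i', k')" by auto
    have "Q i k \<inter> Q i' k' = {}"
    proof (cases "i = i'")
      case True
      then show ?thesis using * Q(2) by (auto simp: disjoint_family_on_def)
    next
      case False
      then have "P i \<inter> P i' = {}" using * P(2) by (auto simp: disjoint_family_on_def)
      then show ?thesis using * Q(1) by blast
    qed
    then show "(case x of (i, k) \<Rightarrow> Q i k) \<inter> (case y of (i, k) \<Rightarrow> Q i k) = {}"
      by (simp add: eq)
  qed
  moreover have "\<forall>x\<in>Sigma I K. (\<lambda>(i, k). Q i k) x \<subseteq> B \<and> (\<lambda>(i, k). Q i k) x \<notin> J"
    using Q(1) P(1) by fast
  ultimately show ?thesis unfolding splits_def by blast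
qed

section \<open>Pressing down for set-valued maps\<close>

text \<open>Induction on the size: press a chosen element of \<open>G \<beta>\<close> to a constant
  \<open>c\<close>, delete \<open>c\<close> and repeat.\<close>

lemma press_finite_sets:
  assumes "pressable B T" "B \<notin> J"
    "\<And>\<beta>. \<beta> \<in> B \<Longrightarrow> G \<beta> \<subseteq> T \<beta> \<and> finite (G \<beta>) \<and> card (G \<beta>) = n"
  obtains B' Z where "B' \<subseteq> B" "B' \<notin> J" "\<And>\<beta>. \<beta> \<in> B' \<Longrightarrow> G \<beta> = Z"
  using assms
proof (induction n arbitrary: B G thesis)
  case 0
  then have "G \<beta> = {}" if "\<beta> \<in> B" for \<beta> using that by (metis card_0_eq)
  then show ?case using 0 by blast
next
  case (Suc n)
  define f where "f \<beta> = (SOME x. x \<in> G \<beta>)" for \<beta>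
  have f: "f \<beta> \<in> G \<beta>" if "\<beta> \<in> B" for \<beta>
    unfolding f_def by (rule someI_ex) (metis Suc.prems(4)[OF that] card.empty equals0I nat.simps(3))
  obtain c where c: "{\<beta> \<in> B. f \<beta> = c} \<notin> J"
    using pressableD[OF Suc.prems(2) subset_refl Suc.prems(3), of f] f Suc.prems(4) by blast
  let ?C = "{\<beta> \<in> B. f \<beta> = c}"
  have "G \<beta> - {c} \<subseteq> T \<beta> \<and> finite (G \<beta> - {c}) \<and> card (G \<beta> - {c}) = n" if "\<beta> \<in> ?C" for \<beta>
    using that f[of \<beta>] Suc.prems(4)[of \<beta>] by auto
  then obtain B' Z where B': "B' \<subseteq> ?C" "B' \<notin> J" "\<And>\<beta>. \<beta> \<in> B' \<Longrightarrow> G \<beta> - {c} = Z"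
    using Suc.IH[of ?C "\<lambda>\<beta>. G \<beta> - {c}"] c pressable_subset[OF Suc.prems(2), of ?C] by blast
  have "G \<beta> = insert c Z" if "\<beta> \<in> B'" for \<beta>
    using B'(3)[OF that] f[of \<beta>] B'(1) that by blast
  then show ?case using Suc.prems(1)[of B' "insert c Z"] B' by blast
qed

text \<open>On a homogeneous set where all \<open>G \<beta>\<close> have one size, enumerate them
  along a common index set. Values of the \<open>i\<close>-th entry with a null fibre are discarded;
  the others have disjoint positive fibres and so split the set. \<open>Z\<close> collects them over
  all \<open>i\<close>.\<close>

lemma press_infinite:
  assumes B: "B \<subseteq> S" "B \<notin> J" and T: "pressable B T"
    and \<nu>: "\<nu> \<in> S" "(\<gamma>, \<nu>) \<in> \<kappa>" and inf: "infinite (underS \<kappa> \<nu>)"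
    and G: "\<And>\<beta>. \<beta> \<in> B \<Longrightarrow> G \<beta> \<subseteq> T \<beta> \<and> |G \<beta>| <o |underS \<kappa> \<nu>|"
  obtains B' Z where "B' \<subseteq> B" "B' \<notin> J" "|Z| <o |underS \<kappa> \<nu>|" "\<And>\<beta>. \<beta> \<in> B' \<Longrightarrow> G \<beta> \<subseteq> Z"
proof -
  have "\<forall>\<beta>\<in>B. \<exists>l. l \<prec> \<nu> \<and> |G \<beta>| =o |underS \<kappa> l|"
    using ex_card_underS_less[OF _ \<nu>(1)] G by metis
  then obtain l where l: "\<And>\<beta>. \<beta> \<in> B \<Longrightarrow> l \<beta> \<prec> \<nu> \<and> |G \<beta>| =o |underS \<kappa> (l \<beta>)|"
    by metis
  \<comment> \<open>The sizes are named by fewer than \<open>\<kappa>\<close> indices, so one index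
    occurs on a positive set.\<close>
  obtain \<rho> where \<rho>: "{\<beta> \<in> B. l \<beta> = \<rho>} \<notin> J"
    using pressableD[OF pressable_const[OF B(1) card_underS_less[OF \<nu>(1)]] subset_refl B(2), of l]
      l by blast
  obtain C where C: "C \<subseteq> {\<beta> \<in> B. l \<beta> = \<rho>}" "homogeneous C"
    using ex_homogeneous[OF _ \<rho>] B(1) by blast
  have CB: "C \<subseteq> B" "C \<subseteq> S" "C \<notin> J"
    using C B by (auto simp: homogeneous_def)
  let ?L = "underS \<kappa> \<rho>"
  have "C \<noteq> {}" using CB empty_in_J by blast
  then have \<rho>\<nu>: "\<rho> \<prec> \<nu>" using C(1) l by blast
  have L_less: "|?L| <o \<kappa>"
    using \<rho>\<nu> prec_in_Field card_underS_less by blast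
  have "\<forall>\<beta>\<in>C. \<exists>f. bij_betw f ?L (G \<beta>)"
    using l C(1) card_of_ordIso ordIso_symmetric by blast
  then obtain f where f: "\<And>\<beta>. \<beta> \<in> C \<Longrightarrow> bij_betw (f \<beta>) ?L (G \<beta>)"
    by metis
  then have f_img: "\<And>\<beta>. \<beta> \<in> C \<Longrightarrow> G \<beta> = f \<beta> ` ?L"
    by (simp add: bij_betw_def)
  define Zi where "Zi i = {z. {\<beta> \<in> C. f \<beta> i = z} \<notin> J}" for i
  have split_Zi: "splits C (Zi i)" for i
    unfolding splits_def
    by (intro exI[of _ "\<lambda>z. {\<beta> \<in> C. f \<beta> i = z}"])
      (auto simp: Zi_def disjoint_family_on_def)
  have null: "{\<beta> \<in> C. f \<beta> i \<notin> Zi i} \<in> J" if i: "i \<in> ?L" for i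
  proof (rule ccontr)
    assume pos: "{\<beta> \<in> C. f \<beta> i \<notin> Zi i} \<notin> J"
    have "f \<beta> i \<in> T \<beta>" if "\<beta> \<in> {\<beta> \<in> C. f \<beta> i \<notin> Zi i}" for \<beta>
      using that i G CB f_img by blast
    then obtain c where c: "{\<beta> \<in> {\<beta> \<in> C. f \<beta> i \<notin> Zi i}. f \<beta> i = c} \<notin> J"
      using pressableD[OF T _ pos, of "\<lambda>\<beta>. f \<beta> i"] CB(1) by blast
    have "{\<beta> \<in> {\<beta> \<in> C. f \<beta> i \<notin> Zi i}. f \<beta> i = c} \<subseteq> {\<beta> \<in> C. f \<beta> i = c}"
      by blast
    then have "{\<beta> \<in> C. f \<beta> i = c} \<notin> J"
      using c J_mono by blast
    then have "c \<in> Zi i" by (simp add: Zi_def)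
    then have "{\<beta> \<in> {\<beta> \<in> C. f \<beta> i \<notin> Zi i}. f \<beta> i = c} = {}" by blast
    then show False using c empty_in_J by metis
  qed
  let ?N = "\<Union>i\<in>?L. {\<beta> \<in> C. f \<beta> i \<notin> Zi i}"
  have "?N \<in> J" by (rule UN_in_J[OF L_less null])
  then have pos: "C - ?N \<notin> J"
    using positive_diff[OF CB(3)] by blast
  let ?Z = "\<Union>i\<in>?L. Zi i"
  have "|?Z| <o |underS \<kappa> \<nu>|"
  \<comment> \<open>If \<open>?L\<close> splits \<open>C\<close>, the values tagged by their index
    form one splitting family, of size below that of \<open>\<gamma>\<close>. Otherwise every
    \<open>Zi i\<close> is smaller than \<open>?L\<close>, so the union is finite or at most as
    large as \<open>?L\<close>.\<close>
  proof (cases "splits C ?L")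
    case True
    then have "splits C (Sigma ?L Zi)"
      using homogeneous_splits_Sigma[OF C(2)] split_Zi by blast
    then have "|Sigma ?L Zi| <o |underS \<kappa> \<gamma>|"
      using splits_card_less CB by blast
    then show ?thesis
      by (intro ordLeq_ordLess_trans[OF card_of_UNION_Sigma]
          ordLess_ordLeq_trans[OF _ card_underS_mono[OF \<nu>(2)]])
  next
    case False
    then have less: "|Zi i| <o |?L|" for i
      using split_Zi[of i] splits_mono[of C "Zi i" ?L]
      by (meson card_of_Well_order not_ordLess_iff_ordLeq)
    show ?thesis
    proof (cases "finite ?L")
      case True
      then have "finite (Zi i)" for i
        by (rule card_of_ordLeq_finite[OF ordLess_imp_ordLeq[OF less]])
      then have "finite ?Z" using True by blast
      then show ?thesis
        using inf by (rule finite_card_of_less_infinite)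
    next
      case False
      then have "|?Z| \<le>o |?L|"
        by (rule card_of_UNION_ordLeq_infinite)
          (simp_all add: card_of_mono1 ordLess_imp_ordLeq[OF less])
      moreover have "|?L| <o |underS \<kappa> \<nu>|"
      proof -
        obtain \<beta> where "\<beta> \<in> C" using \<open>C \<noteq> {}\<close> by blast
        then have "|G \<beta>| =o |?L|" "|G \<beta>| <o |underS \<kappa> \<nu>|"
          using l[of \<beta>] G[of \<beta>] C(1) by blast+
        then show ?thesis
          by (rule ordIso_ordLess_trans[OF ordIso_symmetric])
      qed
      ultimately show ?thesis by (rule ordLeq_ordLess_trans)
    qed
  qed
  moreover have "G \<beta> \<subseteq> ?Z" if \<beta>: "\<beta> \<in> C - ?N" for \<beta>
  proof
    fix z assume "z \<in> G \<beta>"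
    then obtain i where "i \<in> ?L" "z = f \<beta> i"
      using f_img[OF DiffD1[OF \<beta>]] by auto
    then show "z \<in> ?Z" using \<beta> by auto
  qed
  ultimately show thesis
    using CB(1) by (intro that[of "C - ?N" ?Z] pos) blast+
qed

text \<open>
  For finite \<open>\<nu>\<close> the equality \<open>G \<beta> = Z\<close> is needed: there the sizes of the parts of \<open>W\<close> are added, so
  each part has to be charged to its own share of one set of the family.
\<close>

lemma press_sets:
  assumes B: "B \<subseteq> S" "B \<notin> J" and T: "pressable B T"
    and \<nu>: "\<nu> \<in> S" "(\<gamma>, \<nu>) \<in> \<kappa>"
    and G: "\<And>\<beta>. \<beta> \<in> B \<Longrightarrow> G \<beta> \<subseteq> T \<beta> \<and> |G \<beta>| <o |underS \<kappa> \<nu>|"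
  obtains B' Z where "B' \<subseteq> B" "B' \<notin> J" "|Z| <o |underS \<kappa> \<nu>|" "\<And>\<beta>. \<beta> \<in> B' \<Longrightarrow> G \<beta> \<subseteq> Z"
    "\<And>\<beta>. finite (underS \<kappa> \<nu>) \<Longrightarrow> \<beta> \<in> B' \<Longrightarrow> G \<beta> = Z"
proof (cases "finite (underS \<kappa> \<nu>)")
  case True
  let ?n = "card (underS \<kappa> \<nu>)"
  have fin: "finite (G \<beta>)" "card (G \<beta>) < ?n" if "\<beta> \<in> B" for \<beta>
  proof -
    show "finite (G \<beta>)"
      using card_of_ordLeq_finite[OF ordLess_imp_ordLeq True] G[OF that] by blast
    then show "card (G \<beta>) < ?n"
      using \<open>finite (G \<beta>)\<close> G[OF that] True card_of_less_iff_card_less[of "G \<beta>" "underS \<kappa> \<nu>"] by blast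
  qed
  obtain n where n: "{\<beta> \<in> B. card (G \<beta>) = n} \<notin> J"
    using pressableD[OF pressable_const[OF B(1) finite_card_less[of "{..<?n}"]] subset_refl B(2),
        of "\<lambda>\<beta>. card (G \<beta>)"] fin by blast
  obtain B' Z where B': "B' \<subseteq> {\<beta> \<in> B. card (G \<beta>) = n}" "B' \<notin> J" "\<And>\<beta>. \<beta> \<in> B' \<Longrightarrow> G \<beta> = Z"
  proof (rule press_finite_sets[OF pressable_subset[OF T] n, of G n])
    show "G \<beta> \<subseteq> T \<beta> \<and> finite (G \<beta>) \<and> card (G \<beta>) = n" if "\<beta> \<in> {\<beta> \<in> B. card (G \<beta>) = n}" for \<beta>
      using that fin G by blast
  qed auto
  have "B' \<noteq> {}" using B'(2) empty_in_J by auto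
  then obtain \<beta> where "\<beta> \<in> B'" by blast
  then have "|Z| <o |underS \<kappa> \<nu>|" using B' G[of \<beta>] by auto
  then show thesis using that[of B' Z] B' by blast
next
  case False
  then show thesis
    using press_infinite[OF B T \<nu> False G] that by metis
qed

section \<open>Bounds for small sets and positions in pairs\<close>

text \<open>Completeness takes the place of regularity of \<open>\<kappa>\<close>: each point of
  \<open>T\<close> rules out only a null set of bounds.\<close>

lemma bounds_in_J:
  assumes "T \<subseteq> S" "|T| <o \<kappa>"
  shows "{\<beta> \<in> S. \<not> T \<subseteq> underS \<kappa> \<beta>} \<in> J"
proof -
  have "(\<Union>\<xi>\<in>T. {\<beta> \<in> S. \<not> \<xi> \<prec> \<beta>}) \<in> J"
    using assms initial_segment_in_J by (intro UN_in_J) auto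
  then show ?thesis
    by (rule J_mono) blast
qed

text \<open>The bijection carries minimum to minimum and maximum to maximum. As it fixes common
  points, none can be the minimum of one pair and the maximum of the other.\<close>

lemma same_position_pairs:
  assumes "same_position \<kappa> {\<alpha>, \<beta>} {\<alpha>', \<beta>'}" and lt: "\<alpha> \<prec> \<beta>" "\<alpha>' \<prec> \<beta>'"
  shows "\<alpha> \<noteq> \<beta>'" "\<beta> \<noteq> \<alpha>'"
proof -
  obtain f where f: "bij_betw f {\<alpha>, \<beta>} {\<alpha>', \<beta>'}"
    "\<forall>x\<in>{\<alpha>, \<beta>}. \<forall>y\<in>{\<alpha>, \<beta>}. (x, y) \<in> \<kappa> \<longrightarrow> (f x, f y) \<in> \<kappa>"
    "\<forall>x\<in>{\<alpha>, \<beta>} \<inter> {\<alpha>', \<beta>'}. f x = x"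
    using assms(1) unfolding same_position_def by blast
  have neq: "\<alpha> \<noteq> \<beta>" "\<alpha>' \<noteq> \<beta>'" using lt by auto
  have "f \<alpha> \<noteq> f \<beta>"
    using f(1) neq by (auto simp: bij_betw_def)
  moreover have "(f \<alpha>, f \<beta>) \<in> \<kappa>"
    using f(2) lt by (simp add: le_iff_prec_or_eq)
  ultimately have "f \<alpha> \<prec> f \<beta>"
    by (simp add: le_iff_prec_or_eq)
  moreover have "f \<alpha> \<in> {\<alpha>', \<beta>'}" "f \<beta> \<in> {\<alpha>', \<beta>'}"
    using f(1) by (auto simp: bij_betw_def)
  ultimately have "f \<alpha> = \<alpha>'" "f \<beta> = \<beta>'"
    using lt(2) prec_trans[of \<alpha>' \<beta>' \<alpha>'] by auto
  with f(3) neq show "\<alpha> \<noteq> \<beta>'" "\<beta> \<noteq> \<alpha>'" by auto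
qed

section \<open>The weak Delta-system property of \<open>ideal_square \<kappa> J\<close>\<close>

lemma weak_Delta_system:
  assumes \<nu>: "\<nu> \<in> S" "(\<gamma>, \<nu>) \<in> \<kappa>"
  shows "weak_Delta_system_lemma \<kappa> |underS \<kappa> \<nu>| (ideal_square \<kappa> J)"
  unfolding weak_Delta_system_lemma_def
proof (intro ballI allI impI)
  fix X F
  assume X: "X \<in> positive_sets (pairs \<kappa>) (ideal_square \<kappa> J)"
    and F: "\<forall>a\<in>X. F a \<in> subsets_less S |underS \<kappa> \<nu>|"
  define N where "N = underS \<kappa> \<nu>"
  have N_less: "|N| <o \<kappa>"
    unfolding N_def by (rule card_underS_less[OF \<nu>(1)])
  have X_prec: "\<alpha> \<prec> \<beta>" if "(\<alpha>, \<beta>) \<in> X" for \<alpha> \<beta>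
    using X that unfolding positive_sets_def pairs_def by blast
  have F_sub: "F a \<subseteq> S" and F_less: "|F a| <o |N|" if "a \<in> X" for a
    using F that unfolding subsets_less_def N_def by blast+
  have less_\<kappa>: "|T| <o \<kappa>" if "|T| <o |N|" for T :: "'k set"
    using that N_less ordLess_transitive by blast

  \<comment> \<open>Positivity of \<open>X\<close> in the square amounts to positivity of this set
    of first coordinates.\<close>
  define A where "A = {\<alpha> \<in> S. {\<beta> \<in> S. (\<alpha>, \<beta>) \<in> X} \<notin> J}"
  have A_pos: "A \<notin> J"
  proof
    assume "A \<in> J"
    moreover have "S - {\<alpha> \<in> S. {\<beta> \<in> S. (\<alpha>, \<beta>) \<in> X} \<in> J} = A"
      unfolding A_def by blast
    ultimately show False
      using X unfolding positive_sets_def ideal_square_def dual_filter_def by auto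
  qed

  \<comment> \<open>Points closed under \<open>F\<close> on pairs with smaller maximum. For a fixed
    maximum \<open>\<beta>0\<close> there are fewer than \<open>\<kappa>\<close> pairs, so failure
    is null by completeness; normality then treats all \<open>\<beta>0\<close> at once.\<close>
  define E where "E = {\<beta> \<in> S. \<forall>\<alpha> \<beta>0. \<beta>0 \<prec> \<beta> \<longrightarrow> (\<alpha>, \<beta>0) \<in> X \<longrightarrow> F (\<alpha>, \<beta>0) \<subseteq> underS \<kappa> \<beta>}"
  have E_null: "S - E \<in> J"
  proof -
    define M where "M \<beta>0 = (\<Union>\<alpha>\<in>{\<alpha> \<in> underS \<kappa> \<beta>0. (\<alpha>, \<beta>0) \<in> X}.
      {\<beta> \<in> S. \<not> F (\<alpha>, \<beta>0) \<subseteq> underS \<kappa> \<beta>})" for \<beta>0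
    have "M \<beta>0 \<in> J" if "\<beta>0 \<in> S" for \<beta>0
      unfolding M_def
    proof (rule UN_in_J)
      have "|{\<alpha> \<in> underS \<kappa> \<beta>0. (\<alpha>, \<beta>0) \<in> X}| \<le>o |underS \<kappa> \<beta>0|"
        by (rule card_of_mono1) blast
      then show "|{\<alpha> \<in> underS \<kappa> \<beta>0. (\<alpha>, \<beta>0) \<in> X}| <o \<kappa>"
        using card_underS_less[OF that] ordLeq_ordLess_trans by blast
    qed (use F_sub F_less less_\<kappa> bounds_in_J in blast)
    then have "{\<beta> \<in> S. \<exists>\<beta>0. \<beta>0 \<prec> \<beta> \<and> \<beta> \<in> M \<beta>0} \<in> J"
      by (rule diagonal_union_in_J)
    then show ?thesis
      by (rule J_mono) (use X_prec in \<open>auto simp: E_def M_def\<close>)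
  qed

  \<comment> \<open>For finite \<open>N\<close> the exact trace is kept, for the counting in
    \<open>W_bound\<close>.\<close>
  define good1 where "good1 \<alpha> B Z \<longleftrightarrow>
      B \<subseteq> {\<beta> \<in> E. (\<alpha>, \<beta>) \<in> X} \<and> B \<notin> J \<and> Z \<subseteq> S \<and> |Z| <o |N| \<and>
      (\<forall>\<beta>\<in>B. F (\<alpha>, \<beta>) \<inter> underS \<kappa> \<beta> \<subseteq> Z) \<and>
      (finite N \<longrightarrow> (\<forall>\<beta>\<in>B. F (\<alpha>, \<beta>) \<inter> underS \<kappa> \<beta> = Z))" for \<alpha> B Z
  have "\<exists>B Z. good1 \<alpha> B Z" if "\<alpha> \<in> A" for \<alpha>
  proof -
    let ?B = "{\<beta> \<in> E. (\<alpha>, \<beta>) \<in> X}"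
    have pos: "?B \<notin> J"
      by (rule positive_diff[OF _ E_null, of "{\<beta> \<in> S. (\<alpha>, \<beta>) \<in> X}"])
        (use that in \<open>auto simp: A_def\<close>)
    have sub: "?B \<subseteq> S" by (auto simp: E_def)
    have G: "F (\<alpha>, \<beta>) \<inter> underS \<kappa> \<beta> \<subseteq> underS \<kappa> \<beta> \<and> |F (\<alpha>, \<beta>) \<inter> underS \<kappa> \<beta>| <o |underS \<kappa> \<nu>|"
      if "\<beta> \<in> ?B" for \<beta>
      using that F_less[of "(\<alpha>, \<beta>)"] card_of_mono1[of "F (\<alpha>, \<beta>) \<inter> underS \<kappa> \<beta>" "F (\<alpha>, \<beta>)"]
        ordLeq_ordLess_trans unfolding N_def by blast
    obtain B Z where BZ: "B \<subseteq> ?B" "B \<notin> J" "|Z| <o |underS \<kappa> \<nu>|"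
      "\<And>\<beta>. \<beta> \<in> B \<Longrightarrow> F (\<alpha>, \<beta>) \<inter> underS \<kappa> \<beta> \<subseteq> Z"
      "\<And>\<beta>. finite (underS \<kappa> \<nu>) \<Longrightarrow> \<beta> \<in> B \<Longrightarrow> F (\<alpha>, \<beta>) \<inter> underS \<kappa> \<beta> = Z"
      using press_sets[OF sub pos pressable_underS[OF sub] \<nu>,
        of "\<lambda>\<beta>. F (\<alpha>, \<beta>) \<inter> underS \<kappa> \<beta>"] G by blast
    have "|Z \<inter> S| <o |N|"
      using BZ(3) card_of_mono1[of "Z \<inter> S" Z] ordLeq_ordLess_trans unfolding N_def by blast
    moreover have "F (\<alpha>, \<beta>) \<inter> underS \<kappa> \<beta> \<subseteq> Z \<inter> S" if "\<beta> \<in> B" for \<beta>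
      using BZ(4)[OF that] underS_subset_Field by blast
    moreover have "F (\<alpha>, \<beta>) \<inter> underS \<kappa> \<beta> = Z \<inter> S" if "finite N" "\<beta> \<in> B" for \<beta>
      using BZ(5)[OF _ that(2)] that(1) underS_subset_Field unfolding N_def by blast
    ultimately show ?thesis
      using BZ(1,2) unfolding good1_def by (intro exI[of _ B] exI[of _ "Z \<inter> S"]) blast
  qed
  then obtain B Z where good1: "\<And>\<alpha>. \<alpha> \<in> A \<Longrightarrow> good1 \<alpha> (B \<alpha>) (Z \<alpha>)"
    by metis
  then have B: "\<And>\<alpha>. \<alpha> \<in> A \<Longrightarrow> B \<alpha> \<subseteq> {\<beta> \<in> E. (\<alpha>, \<beta>) \<in> X}" "\<And>\<alpha>. \<alpha> \<in> A \<Longrightarrow> B \<alpha> \<notin> J"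
    and Z: "\<And>\<alpha>. \<alpha> \<in> A \<Longrightarrow> Z \<alpha> \<subseteq> S" "\<And>\<alpha>. \<alpha> \<in> A \<Longrightarrow> |Z \<alpha>| <o |N|"
    and BZ: "\<And>\<alpha> \<beta>. \<alpha> \<in> A \<Longrightarrow> \<beta> \<in> B \<alpha> \<Longrightarrow> F (\<alpha>, \<beta>) \<inter> underS \<kappa> \<beta> \<subseteq> Z \<alpha>"
      "\<And>\<alpha> \<beta>. finite N \<Longrightarrow> \<alpha> \<in> A \<Longrightarrow> \<beta> \<in> B \<alpha> \<Longrightarrow> F (\<alpha>, \<beta>) \<inter> underS \<kappa> \<beta> = Z \<alpha>"
    unfolding good1_def by blast+

  \<comment> \<open>Points closed under \<open>Z\<close>; this closure is what forces
    \<open>Z \<alpha> \<inter> Z \<alpha>'\<close> into \<open>Z0\<close> later.\<close>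
  define E' where "E' = {\<beta> \<in> S. \<forall>\<alpha>. \<alpha> \<prec> \<beta> \<longrightarrow> \<alpha> \<in> A \<longrightarrow> Z \<alpha> \<subseteq> underS \<kappa> \<beta>}"
  have E'_null: "S - E' \<in> J"
  proof -
    have "(if \<alpha> \<in> A then {\<beta> \<in> S. \<not> Z \<alpha> \<subseteq> underS \<kappa> \<beta>} else {}) \<in> J" for \<alpha>
      using Z less_\<kappa> bounds_in_J empty_in_J by simp
    then have "{\<beta> \<in> S. \<exists>\<alpha>. \<alpha> \<prec> \<beta> \<and>
        \<beta> \<in> (if \<alpha> \<in> A then {\<beta> \<in> S. \<not> Z \<alpha> \<subseteq> underS \<kappa> \<beta>} else {})} \<in> J"
      by (rule diagonal_union_in_J)
    then show ?thesis
      by (rule J_mono) (auto simp: E'_def)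
  qed

  \<comment> \<open>Each element of \<open>F a\<close> gets an index in \<open>N\<close>, so that
    elements beyond \<open>\<beta>\<close> can be named by small data.\<close>
  have "\<forall>a\<in>X. \<exists>e. inj_on e (F a) \<and> e ` F a \<subseteq> N"
    using F_less card_of_ordLeq ordLess_imp_ordLeq by blast
  then obtain e where e: "\<And>a. a \<in> X \<Longrightarrow> inj_on (e a) (F a)" "\<And>a. a \<in> X \<Longrightarrow> e a ` F a \<subseteq> N"
    by metis
  \<comment> \<open>Pressing down cannot reach these elements directly, as they are not below
    \<open>\<beta>\<close>. For each, \<open>p\<close> selects an earlier first coordinate over the
    same \<open>\<beta>\<close>, and \<open>G\<close> replaces the element by that coordinate and
    the index there.\<close>
  define D where "D \<alpha> \<beta> = {\<xi> \<in> F (\<alpha>, \<beta>) - underS \<kappa> \<beta>.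
    \<exists>\<alpha>'. \<alpha>' \<prec> \<alpha> \<and> (\<alpha>', \<beta>) \<in> X \<and> \<xi> \<in> F (\<alpha>', \<beta>)}" for \<alpha> \<beta>
  define p where "p \<alpha> \<beta> \<xi> = (SOME \<alpha>'. \<alpha>' \<prec> \<alpha> \<and> (\<alpha>', \<beta>) \<in> X \<and> \<xi> \<in> F (\<alpha>', \<beta>))" for \<alpha> \<beta> \<xi>
  have p: "p \<alpha> \<beta> \<xi> \<prec> \<alpha> \<and> (p \<alpha> \<beta> \<xi>, \<beta>) \<in> X \<and> \<xi> \<in> F (p \<alpha> \<beta> \<xi>, \<beta>)" if "\<xi> \<in> D \<alpha> \<beta>" for \<alpha> \<beta> \<xi>
    unfolding p_def by (rule someI_ex) (use that in \<open>simp add: D_def\<close>)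
  define G where "G \<alpha> \<beta> = (\<lambda>\<xi>. (p \<alpha> \<beta> \<xi>, e (p \<alpha> \<beta> \<xi>, \<beta>) \<xi>)) ` D \<alpha> \<beta>" for \<alpha> \<beta>
  have G_sub: "G \<alpha> \<beta> \<subseteq> underS \<kappa> \<alpha> \<times> N" for \<alpha> \<beta>
    using p e(2) unfolding G_def by blast
  have G_less: "|G \<alpha> \<beta>| <o |N|" if "(\<alpha>, \<beta>) \<in> X" for \<alpha> \<beta>
  proof -
    have "|G \<alpha> \<beta>| \<le>o |D \<alpha> \<beta>|"
      unfolding G_def by (rule card_of_image)
    also have "|D \<alpha> \<beta>| \<le>o |F (\<alpha>, \<beta>)|"
      by (rule card_of_mono1) (auto simp: D_def)
    finally show ?thesis
      using F_less[OF that] ordLeq_ordLess_trans by blast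
  qed

  define good2 where "good2 \<alpha> C H \<longleftrightarrow>
      C \<subseteq> B \<alpha> \<inter> E' \<and> C \<notin> J \<and> H \<subseteq> underS \<kappa> \<alpha> \<times> N \<and> |H| <o |N| \<and>
      (\<forall>\<beta>\<in>C. G \<alpha> \<beta> \<subseteq> H) \<and> (finite N \<longrightarrow> (\<forall>\<beta>\<in>C. G \<alpha> \<beta> = H))" for \<alpha> C H
  have "\<exists>C H. good2 \<alpha> C H" if \<alpha>: "\<alpha> \<in> A" for \<alpha>
  proof -
    have sub: "B \<alpha> \<inter> E' \<subseteq> S" by (auto simp: E'_def)
    have pos: "B \<alpha> \<inter> E' \<notin> J"
      by (rule positive_diff[OF B(2)[OF \<alpha>] E'_null]) (use B(1)[OF \<alpha>] in \<open>auto simp: E_def\<close>)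
    have "|underS \<kappa> \<alpha>| <o \<kappa>"
      using \<alpha> card_underS_less by (simp add: A_def)
    \<comment> \<open>With \<open>\<alpha>\<close> fixed, both components of a code range over small
      sets independent of \<open>\<beta>\<close>.\<close>
    then have press: "pressable (B \<alpha> \<inter> E') (\<lambda>\<beta>. underS \<kappa> \<alpha> \<times> N)"
      using pressable_Times pressable_const[OF sub] N_less by blast
    have G: "G \<alpha> \<beta> \<subseteq> underS \<kappa> \<alpha> \<times> N \<and> |G \<alpha> \<beta>| <o |underS \<kappa> \<nu>|" if "\<beta> \<in> B \<alpha> \<inter> E'" for \<beta>
      using that B(1)[OF \<alpha>] G_sub G_less unfolding N_def by blast
    obtain C H where CH: "C \<subseteq> B \<alpha> \<inter> E'" "C \<notin> J" "|H| <o |underS \<kappa> \<nu>|"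
      "\<And>\<beta>. \<beta> \<in> C \<Longrightarrow> G \<alpha> \<beta> \<subseteq> H"
      "\<And>\<beta>. finite (underS \<kappa> \<nu>) \<Longrightarrow> \<beta> \<in> C \<Longrightarrow> G \<alpha> \<beta> = H"
      using press_sets[OF sub pos press \<nu>, of "G \<alpha>"] G by blast
    let ?H = "H \<inter> underS \<kappa> \<alpha> \<times> N"
    have "|?H| <o |N|"
      using CH(3) card_of_mono1[of ?H H] ordLeq_ordLess_trans unfolding N_def by blast
    moreover have "G \<alpha> \<beta> \<subseteq> ?H" if "\<beta> \<in> C" for \<beta>
      using CH(4)[OF that] G_sub by blast
    moreover have "G \<alpha> \<beta> = ?H" if "finite N" "\<beta> \<in> C" for \<beta>
      using CH(5)[OF _ that(2)] that(1) G_sub[of \<alpha> \<beta>] unfolding N_def by blast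
    ultimately show ?thesis
      using CH(1,2) unfolding good2_def by (intro exI[of _ C] exI[of _ ?H]) blast
  qed
  then obtain C H where good2: "\<And>\<alpha>. \<alpha> \<in> A \<Longrightarrow> good2 \<alpha> (C \<alpha>) (H \<alpha>)"
    by metis
  then have C: "\<And>\<alpha>. \<alpha> \<in> A \<Longrightarrow> C \<alpha> \<subseteq> B \<alpha> \<inter> E'" "\<And>\<alpha>. \<alpha> \<in> A \<Longrightarrow> C \<alpha> \<notin> J"
    and H: "\<And>\<alpha>. \<alpha> \<in> A \<Longrightarrow> H \<alpha> \<subseteq> underS \<kappa> \<alpha> \<times> N" "\<And>\<alpha>. \<alpha> \<in> A \<Longrightarrow> |H \<alpha>| <o |N|"
    and CH: "\<And>\<alpha> \<beta>. \<alpha> \<in> A \<Longrightarrow> \<beta> \<in> C \<alpha> \<Longrightarrow> G \<alpha> \<beta> \<subseteq> H \<alpha>"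
      "\<And>\<alpha> \<beta>. finite N \<Longrightarrow> \<alpha> \<in> A \<Longrightarrow> \<beta> \<in> C \<alpha> \<Longrightarrow> G \<alpha> \<beta> = H \<alpha>"
    unfolding good2_def by blast+

  have "A \<inter> E \<notin> J"
    by (rule positive_diff[OF A_pos E_null]) (auto simp: A_def)
  then have pos0: "A \<inter> E \<inter> E' \<notin> J"
    by (rule positive_diff[OF _ E'_null]) (auto simp: A_def)
  have sub0: "A \<inter> E \<inter> E' \<subseteq> S" by (auto simp: A_def)
  have "Z \<alpha> \<inter> underS \<kappa> \<alpha> \<subseteq> underS \<kappa> \<alpha> \<and> |Z \<alpha> \<inter> underS \<kappa> \<alpha>| <o |underS \<kappa> \<nu>|"
    if "\<alpha> \<in> A \<inter> E \<inter> E'" for \<alpha>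
    using that Z(2)[of \<alpha>] card_of_mono1[of "Z \<alpha> \<inter> underS \<kappa> \<alpha>" "Z \<alpha>"]
      ordLeq_ordLess_trans unfolding N_def by blast
  then obtain A1 Z0 where A1: "A1 \<subseteq> A \<inter> E \<inter> E'" "A1 \<notin> J" and Z0_less: "|Z0| <o |underS \<kappa> \<nu>|"
    and Z0: "\<And>\<alpha>. \<alpha> \<in> A1 \<Longrightarrow> Z \<alpha> \<inter> underS \<kappa> \<alpha> \<subseteq> Z0"
      "\<And>\<alpha>. finite (underS \<kappa> \<nu>) \<Longrightarrow> \<alpha> \<in> A1 \<Longrightarrow> Z \<alpha> \<inter> underS \<kappa> \<alpha> = Z0"
    using press_sets[OF sub0 pos0 pressable_underS[OF sub0] \<nu>,
        of "\<lambda>\<alpha>. Z \<alpha> \<inter> underS \<kappa> \<alpha>"] by blast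
  have A1_sub: "A1 \<subseteq> S" using A1(1) sub0 by blast
  \<comment> \<open>Now \<open>\<alpha>\<close> varies, and the first component of a code is
    regressive.\<close>
  have press1: "pressable A1 (\<lambda>\<alpha>. underS \<kappa> \<alpha> \<times> N)"
    using pressable_Times[OF pressable_underS pressable_const] A1_sub N_less by blast
  have "H \<alpha> \<subseteq> underS \<kappa> \<alpha> \<times> N \<and> |H \<alpha>| <o |underS \<kappa> \<nu>|" if "\<alpha> \<in> A1" for \<alpha>
    using that H A1(1) unfolding N_def by blast
  then obtain A2 H0 where A2: "A2 \<subseteq> A1" "A2 \<notin> J" and H0_less: "|H0| <o |underS \<kappa> \<nu>|"
    and H0: "\<And>\<alpha>. \<alpha> \<in> A2 \<Longrightarrow> H \<alpha> \<subseteq> H0"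
      "\<And>\<alpha>. finite (underS \<kappa> \<nu>) \<Longrightarrow> \<alpha> \<in> A2 \<Longrightarrow> H \<alpha> = H0"
    using press_sets[OF A1_sub A1(2) press1 \<nu>, of H] by blast
  have A2_sub: "A2 \<subseteq> A" "A2 \<subseteq> E" "A2 \<subseteq> E'" using A1 A2 by blast+

  \<comment> \<open>Decoding at \<open>\<beta>\<close>. A pair that codes nothing there yields an
    arbitrary value; the size of \<open>R \<beta>\<close> is bounded by that of \<open>H0\<close>
    all the same, and \<open>W\<close> is cut down to \<open>S\<close>.\<close>
  define R where "R \<beta> = (\<lambda>(\<alpha>, j). inv_into (F (\<alpha>, \<beta>)) (e (\<alpha>, \<beta>)) j) ` H0" for \<beta>
  have D_R: "D \<alpha> \<beta> \<subseteq> R \<beta>" if "\<alpha> \<in> A2" "\<beta> \<in> C \<alpha>" for \<alpha> \<beta>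
  proof
    fix \<xi> assume \<xi>: "\<xi> \<in> D \<alpha> \<beta>"
    let ?a = "(p \<alpha> \<beta> \<xi>, \<beta>)"
    have "(p \<alpha> \<beta> \<xi>, e ?a \<xi>) \<in> H0"
      using \<xi> CH(1)[of \<alpha> \<beta>] H0(1)[OF that(1)] A2_sub that unfolding G_def by blast
    moreover have "inv_into (F ?a) (e ?a) (e ?a \<xi>) = \<xi>"
      using p[OF \<xi>] e(1) by simp
    ultimately show "\<xi> \<in> R \<beta>"
      unfolding R_def by force
  qed
  \<comment> \<open>\<open>W\<close> sees a common point \<open>x\<close> but not its role:
    \<open>Z x\<close> serves pairs with common minimum \<open>x\<close>, \<open>R x\<close> those
    with common maximum \<open>x\<close>, and \<open>Z0\<close> all others.\<close>
  define W where "W s = (Z0 \<union> (\<Union>x\<in>s. (if x \<in> A2 then Z x else {}) \<union> R x)) \<inter> S" for s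
  define Y where "Y = {(\<alpha>, \<beta>). \<alpha> \<in> A2 \<and> \<beta> \<in> C \<alpha>}"
  have Y: "\<alpha> \<in> A2" "\<alpha> \<in> A" "\<alpha> \<in> E" "\<alpha> \<in> E'" "\<beta> \<in> C \<alpha>" "\<beta> \<in> B \<alpha>" "\<beta> \<in> E" "\<beta> \<in> E'" "(\<alpha>, \<beta>) \<in> X"
    "\<alpha> \<prec> \<beta>" if "(\<alpha>, \<beta>) \<in> Y" for \<alpha> \<beta>
    using that A2_sub B(1)[of \<alpha>] C(1)[of \<alpha>] X_prec[of \<alpha> \<beta>] unfolding Y_def by blast+
  have F_below: "F (\<alpha>, \<beta>) \<inter> underS \<kappa> \<beta> \<subseteq> Z \<alpha>" if "(\<alpha>, \<beta>) \<in> Y" for \<alpha> \<beta>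
    using BZ(1) Y[OF that] by blast
  have F_bounded: "F (\<alpha>, \<beta>) \<subseteq> underS \<kappa> \<beta>'" if "(\<alpha>, \<beta>) \<in> Y" "\<beta> \<prec> \<beta>'" "\<beta>' \<in> E" for \<alpha> \<beta> \<beta>'
    using that Y(9) unfolding E_def by blast
  have Z_bounded: "Z \<alpha> \<subseteq> underS \<kappa> \<beta>" if "\<alpha> \<in> A2" "\<alpha> \<prec> \<beta>" "\<beta> \<in> E'" for \<alpha> \<beta>
    using that A2_sub unfolding E'_def by blast
  have Z_below: "Z \<alpha> \<inter> underS \<kappa> \<alpha> \<subseteq> Z0" if "\<alpha> \<in> A2" for \<alpha>
    using that A2 Z0(1) by blast
  have Z_Int: "Z \<alpha> \<inter> Z \<alpha>' \<subseteq> Z0" if "\<alpha> \<in> A2" "\<alpha>' \<in> A2" "\<alpha> \<noteq> \<alpha>'" for \<alpha> \<alpha>'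
  proof -
    \<comment> \<open>\<open>y \<in> E'\<close> puts \<open>Z x\<close> below \<open>y\<close>, and
      \<open>Z0\<close> contains the part of \<open>Z y\<close> below \<open>y\<close>.\<close>
    have *: "Z x \<inter> Z y \<subseteq> Z0" if "x \<in> A2" "y \<in> A2" "x \<prec> y" for x y
      using Z_bounded[OF that(1,3)] Z_below[OF that(2)] A2_sub that by blast
    show ?thesis
      using prec_linear[of \<alpha> \<alpha>'] *[of \<alpha> \<alpha>'] *[of \<alpha>' \<alpha>] that A2_sub unfolding A_def by blast
  qed

  have A2_ne: "A2 \<noteq> {}" using A2(2) empty_in_J by auto
  \<comment> \<open>For finite \<open>N\<close> everything is charged to one set
    \<open>F (\<alpha>, \<beta>)\<close> with \<open>\<beta> \<in> C \<alpha>\<close>, where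
    \<open>\<beta>\<close> need not be related to \<open>x\<close>: \<open>Z0\<close> and
    \<open>V\<close> lie in its part below \<open>\<beta>\<close>, and \<open>R x\<close> has at
    most as many elements as the rest, since \<open>H0 = G \<alpha> \<beta>\<close>.\<close>
  have W_bound: "|Z0 \<union> V \<union> R x| <o |N|" if \<alpha>: "\<alpha> \<in> A2" and V: "V \<subseteq> Z \<alpha>" for \<alpha> V x
  proof (cases "finite N")
    case True
    have "C \<alpha> \<noteq> {}" using C(2)[of \<alpha>] A2_sub \<alpha> empty_in_J by (metis subsetD)
    then obtain \<beta> where \<beta>: "\<beta> \<in> C \<alpha>" by blast
    have Y\<beta>: "(\<alpha>, \<beta>) \<in> Y" using \<alpha> \<beta> by (simp add: Y_def)
    have Z_eq: "Z \<alpha> = F (\<alpha>, \<beta>) \<inter> underS \<kappa> \<beta>"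
      using BZ(2)[OF True] Y[OF Y\<beta>] by simp
    have Z0_eq: "Z0 = Z \<alpha> \<inter> underS \<kappa> \<alpha>"
      using Z0(2) True \<alpha> A2 unfolding N_def by blast
    have H0_eq: "H0 = G \<alpha> \<beta>"
      using H0(2)[of \<alpha>] CH(2)[OF True, of \<alpha> \<beta>] True \<alpha> \<beta> A2_sub unfolding N_def by blast
    have fin: "finite (F (\<alpha>, \<beta>))"
      by (rule card_of_ordLeq_finite[OF ordLess_imp_ordLeq[OF F_less[OF Y(9)[OF Y\<beta>]]] True])
    have D_sub: "D \<alpha> \<beta> \<subseteq> F (\<alpha>, \<beta>) - underS \<kappa> \<beta>"
      by (auto simp: D_def)
    then have finD: "finite (D \<alpha> \<beta>)" using fin finite_subset by blast
    have finR: "finite (R x)"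
      unfolding R_def H0_eq G_def using finD by simp
    have "card (R x) \<le> card (G \<alpha> \<beta>)"
      unfolding R_def H0_eq by (rule card_image_le) (simp add: G_def finD)
    also have "\<dots> \<le> card (D \<alpha> \<beta>)"
      unfolding G_def by (rule card_image_le[OF finD])
    also have "\<dots> \<le> card (F (\<alpha>, \<beta>) - underS \<kappa> \<beta>)"
      using D_sub fin by (intro card_mono) auto
    finally have R: "card (R x) \<le> card (F (\<alpha>, \<beta>) - underS \<kappa> \<beta>)" .
    have sub: "Z0 \<union> V \<union> R x \<subseteq> F (\<alpha>, \<beta>) \<inter> underS \<kappa> \<beta> \<union> R x"
      using V Z0_eq Z_eq by blast
    then have "card (Z0 \<union> V \<union> R x) \<le> card (F (\<alpha>, \<beta>) \<inter> underS \<kappa> \<beta> \<union> R x)"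
      by (rule card_mono[rotated]) (simp add: fin finR)
    also have "\<dots> \<le> card (F (\<alpha>, \<beta>) \<inter> underS \<kappa> \<beta>) + card (R x)"
      by (rule card_Un_le)
    also have "\<dots> \<le> card (F (\<alpha>, \<beta>) \<inter> underS \<kappa> \<beta>) + card (F (\<alpha>, \<beta>) - underS \<kappa> \<beta>)"
      using R by simp
    also have "\<dots> = card (F (\<alpha>, \<beta>))"
      by (rule card_Int_Diff[OF fin, symmetric])
    also have "\<dots> < card N"
      using F_less[OF Y(9)[OF Y\<beta>]] card_of_less_iff_card_less[OF fin True] by blast
    finally have "card (Z0 \<union> V \<union> R x) < card N" .
    moreover have "finite (Z0 \<union> V \<union> R x)"
      using finite_subset[OF sub] finR fin by blast
    ultimately show ?thesis
      using card_of_less_iff_card_less[OF _ True, of "Z0 \<union> V \<union> R x"] by blast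
  next
    case False
    have "|V| <o |N|"
      using ordLeq_ordLess_trans[OF card_of_mono1[OF V] Z(2)] \<alpha> A2_sub by blast
    moreover have "|R x| <o |N|"
      unfolding R_def N_def by (rule ordLeq_ordLess_trans[OF card_of_image H0_less])
    ultimately show ?thesis
      using card_of_Un_ordLess_infinite[OF False] Z0_less[folded N_def] by blast
  qed
  have W_small: "W s \<in> subsets_less S |underS \<kappa> \<nu>|" if s: "s \<in> subsets_le_one S" for s
  proof -
    have "finite s" "card s \<le> Suc 0"
      using s by (auto simp: subsets_le_one_def)
    then have "\<forall>x\<in>s. \<forall>y\<in>s. x = y"
      using card_le_Suc0_iff_eq by blast
    then obtain x where x: "s \<subseteq> {x}"
      by blast
    \<comment> \<open>For \<open>x\<close> outside \<open>A2\<close> the contribution of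
      \<open>Z\<close> is empty, and any element of \<open>A2\<close> serves.\<close>
    obtain \<alpha> where \<alpha>: "\<alpha> \<in> A2" "(if x \<in> A2 then Z x else {}) \<subseteq> Z \<alpha>"
      using A2_ne by (cases "x \<in> A2") auto
    have sub: "W s \<subseteq> Z0 \<union> (if x \<in> A2 then Z x else {}) \<union> R x"
      using x unfolding W_def by blast
    have "|W s| <o |N|"
      by (rule ordLeq_ordLess_trans[OF card_of_mono1[OF sub] W_bound[OF \<alpha>]])
    then show ?thesis
      by (simp add: subsets_less_def N_def W_def)
  qed
  have Y_sub: "Y \<subseteq> X" using Y(9) by auto
  have Y_pos: "Y \<in> positive_sets (pairs \<kappa>) (ideal_square \<kappa> J)"
  proof -
    have "{\<beta> \<in> S. (\<alpha>, \<beta>) \<in> Y} \<notin> J" if "\<alpha> \<in> A2" for \<alpha>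
    proof -
      have "{\<beta> \<in> S. (\<alpha>, \<beta>) \<in> Y} = C \<alpha>"
        using that C(1)[of \<alpha>] A2_sub unfolding Y_def E'_def by blast
      then show ?thesis using C(2) that A2_sub by auto
    qed
    \<comment> \<open>If \<open>Y\<close> were null in the square, this complement would be in
      \<open>J\<close>, and \<open>A2\<close> with it.\<close>
    then have "A2 \<subseteq> S - {\<alpha> \<in> S. {\<beta> \<in> S. (\<alpha>, \<beta>) \<in> Y} \<in> J}"
      using A2_sub unfolding A_def by blast
    then have "Y \<notin> ideal_square \<kappa> J"
      using A2(2) J_mono unfolding ideal_square_def dual_filter_def by blast
    then show ?thesis
      using Y_sub X unfolding positive_sets_def by blast
  qed

  have ltmax: "F (\<alpha>, \<beta>) \<inter> F (\<alpha>', \<beta>') \<subseteq> W ({\<alpha>, \<beta>} \<inter> {\<alpha>', \<beta>'})"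
    if a: "(\<alpha>, \<beta>) \<in> Y" and b: "(\<alpha>', \<beta>') \<in> Y" and lt: "\<beta> \<prec> \<beta>'" and ne: "\<beta> \<noteq> \<alpha>'" for \<alpha> \<beta> \<alpha>' \<beta>'
  proof
    fix \<xi> assume \<xi>: "\<xi> \<in> F (\<alpha>, \<beta>) \<inter> F (\<alpha>', \<beta>')"
    then have \<xi>S: "\<xi> \<in> S" using F_sub[OF Y(9)[OF a]] by blast
    \<comment> \<open>As \<open>\<beta>'\<close> is in \<open>E\<close>, all of
      \<open>F (\<alpha>, \<beta>)\<close> lies below \<open>\<beta>'\<close>, where
      \<open>Z \<alpha>'\<close> covers \<open>F (\<alpha>', \<beta>')\<close>.\<close>
    have \<xi>Z': "\<xi> \<in> Z \<alpha>'"
      using \<xi> F_bounded[OF a lt Y(7)[OF b]] F_below[OF b] by blast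
    show "\<xi> \<in> W ({\<alpha>, \<beta>} \<inter> {\<alpha>', \<beta>'})"
    proof (cases "\<alpha> = \<alpha>'")
      case True
      then show ?thesis using \<xi>Z' \<xi>S Y(1)[OF b] by (simp add: W_def)
    next
      case False
      have "\<alpha>' \<in> S" "\<beta> \<in> S"
        using Y(10)[OF a] Y(10)[OF b] prec_in_Field by blast+
      \<comment> \<open>\<open>ne\<close> excludes equality. If
        \<open>\<alpha>' \<prec> \<beta>\<close>, closure of \<open>\<beta>\<close> under
        \<open>Z\<close> puts \<open>\<xi>\<close> into both \<open>Z \<alpha>\<close> and
        \<open>Z \<alpha>'\<close>; if \<open>\<beta> \<prec> \<alpha>'\<close>, closure of
        \<open>\<alpha>'\<close> under \<open>F\<close> puts \<open>\<xi>\<close> below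
        \<open>\<alpha>'\<close>.\<close>
      then consider "\<alpha>' \<prec> \<beta>" | "\<beta> \<prec> \<alpha>'" using prec_linear ne by blast
      then have "\<xi> \<in> Z0"
      proof cases
        case 1
        then have "\<xi> \<prec> \<beta>" using \<xi>Z' Z_bounded[OF Y(1)[OF b] 1 Y(8)[OF a]] by blast
        then have "\<xi> \<in> Z \<alpha>" using F_below[OF a] \<xi> by blast
        then show ?thesis using \<xi>Z' Z_Int[OF Y(1)[OF a] Y(1)[OF b] False] by blast
      next
        case 2
        then have "\<xi> \<prec> \<alpha>'" using \<xi> F_bounded[OF a 2 Y(3)[OF b]] by blast
        then show ?thesis using \<xi>Z' Z_below[OF Y(1)[OF b]] by blast
      qed
      then show ?thesis using \<xi>S by (simp add: W_def)
    qed
  qed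
  have eqmax: "F (\<alpha>, \<beta>) \<inter> F (\<alpha>', \<beta>) \<subseteq> W ({\<alpha>, \<beta>} \<inter> {\<alpha>', \<beta>})"
    if a: "(\<alpha>, \<beta>) \<in> Y" and b: "(\<alpha>', \<beta>) \<in> Y" and lt: "\<alpha>' \<prec> \<alpha>" for \<alpha> \<beta> \<alpha>'
  proof
    fix \<xi> assume \<xi>: "\<xi> \<in> F (\<alpha>, \<beta>) \<inter> F (\<alpha>', \<beta>)"
    then have \<xi>S: "\<xi> \<in> S" using F_sub[OF Y(9)[OF a]] by blast
    show "\<xi> \<in> W ({\<alpha>, \<beta>} \<inter> {\<alpha>', \<beta>})"
    proof (cases "\<xi> \<prec> \<beta>")
      case True
      then have "\<xi> \<in> Z \<alpha> \<inter> Z \<alpha>'" using F_below[OF a] F_below[OF b] \<xi> by blast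
      moreover have "\<alpha> \<noteq> \<alpha>'" using lt by auto
      ultimately have "\<xi> \<in> Z0" using Z_Int[OF Y(1)[OF a] Y(1)[OF b]] by blast
      then show ?thesis using \<xi>S by (simp add: W_def)
    next
      case False
      \<comment> \<open>The codes are made for this case: \<open>\<alpha>'\<close> witnesses
        membership in \<open>D \<alpha> \<beta>\<close>, and \<open>R \<beta>\<close> is part of
        \<open>W\<close> because \<open>\<beta>\<close> is a common point.\<close>
      then have "\<xi> \<in> D \<alpha> \<beta>" using \<xi> lt Y(9)[OF b] unfolding D_def by blast
      then have "\<xi> \<in> R \<beta>" using D_R Y[OF a] by blast
      then show ?thesis using \<xi>S unfolding W_def by blast
    qed
  qed
  have F_W: "F a \<inter> F b \<subseteq> W (pair_set a \<inter> pair_set b)"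
    if ab: "a \<in> Y" "b \<in> Y" "a \<noteq> b" "same_position \<kappa> (pair_set a) (pair_set b)" for a b
  proof -
    obtain \<alpha> \<beta> \<alpha>' \<beta>' where eq: "a = (\<alpha>, \<beta>)" "b = (\<alpha>', \<beta>')"
      by (cases a, cases b) blast
    note a = ab(1)[unfolded eq] and b = ab(2)[unfolded eq]
    have "same_position \<kappa> {\<alpha>, \<beta>} {\<alpha>', \<beta>'}"
      using ab(4) by (simp add: eq pair_set_def)
    from same_position_pairs[OF this Y(10)[OF a] Y(10)[OF b]]
    have ne: "\<alpha> \<noteq> \<beta>'" "\<beta> \<noteq> \<alpha>'" .
    have inS: "\<alpha> \<in> S" "\<beta> \<in> S" "\<alpha>' \<in> S" "\<beta>' \<in> S"
      using Y(10)[OF a] Y(10)[OF b] prec_in_Field by blast+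
    consider "\<beta> \<prec> \<beta>'" | "\<beta>' \<prec> \<beta>" | "\<beta> = \<beta>'" "\<alpha>' \<prec> \<alpha>" | "\<beta> = \<beta>'" "\<alpha> \<prec> \<alpha>'"
      using prec_linear inS ab(3) eq by blast
    then have "F (\<alpha>, \<beta>) \<inter> F (\<alpha>', \<beta>') \<subseteq> W ({\<alpha>, \<beta>} \<inter> {\<alpha>', \<beta>'})"
    proof cases
      case 1
      then show ?thesis using ltmax[OF a b] ne by blast
    next
      case 2
      then show ?thesis using ltmax[OF b a] ne by (metis Int_commute)
    next
      case 3
      then show ?thesis using eqmax[of \<alpha> \<beta> \<alpha>'] a b by blast
    next
      case 4
      then show ?thesis using eqmax[of \<alpha>' \<beta> \<alpha>] a b by (metis Int_commute)
    qed
    then show ?thesis by (simp add: eq pair_set_def)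
  qed
  show "\<exists>W Y. (\<forall>s\<in>subsets_le_one S. W s \<in> subsets_less S |underS \<kappa> \<nu>| ) \<and>
      Y \<subseteq> X \<and> Y \<in> positive_sets (pairs \<kappa>) (ideal_square \<kappa> J) \<and>
      (\<forall>a\<in>Y. \<forall>b\<in>Y. a \<noteq> b \<and> same_position \<kappa> (pair_set a) (pair_set b) \<longrightarrow>
         F a \<inter> F b \<subseteq> W (pair_set a \<inter> pair_set b))"
  proof (rule exI[of _ W], rule exI[of _ Y], intro conjI ballI impI)
    fix a b
    assume "a \<in> Y" "b \<in> Y" "a \<noteq> b \<and> same_position \<kappa> (pair_set a) (pair_set b)"
    then show "F a \<inter> F b \<subseteq> W (pair_set a \<inter> pair_set b)"
      using F_W by simp
  qed (rule W_small Y_sub Y_pos; assumption?)+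
qed

end

theorem theorem2p1:
  fixes \<kappa> :: "'k rel" and J :: "'k set set" and \<gamma> :: 'k
  assumes "Card_order \<kappa>"
    and "proper_uniform_ideal \<kappa> J"
    and "normal_ideal \<kappa> J"
    and "\<gamma> \<in> Field \<kappa>"
    and "saturated_ideal \<kappa> \<gamma> J"
  shows "\<forall>\<nu> \<in> Field \<kappa>. (\<gamma>, \<nu>) \<in> \<kappa> \<longrightarrow>
    weak_Delta_system_lemma \<kappa> (card_of (underS \<kappa> \<nu>)) (ideal_square \<kappa> J)"
proof -
  interpret normal_saturated_ideal \<kappa> J \<gamma>
    using assms by unfold_locales
  show ?thesis
    by (intro ballI impI weak_Delta_system)
qed

end
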